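(* Let $G$ be a connected graph with a countably infinite vertex set. Then $G$ admits a flexible realization in $\mathbb{R}^2$ if and only if $G$ has a NAC-coloring.
   Context: Graphs are simple. A realization of a graph $G=(V_G,E_G)$ is a map $\rho\colon V_G\to\mathbb{R}^2$ with $\rho(u)\neq\rho(v)$ for every edge $uv\in E_G$; the pair $(G,\rho)$ is a framework. A flex of $(G,\rho)$ is a path $t\mapsto\rho_t$, $t\in[0,\varepsilon)$ for some $\varepsilon>0$, of realizations of $G$ such that each $t\mapsto\rho_t(v)$ is continuous, $\rho_0=\rho$, and $\|\rho_t(u)-\rho_t(v)\|=\|\rho(u)-\rho(v)\|$ for all $uv\in E_G$ and all $t$. The flex is trivial if for every $t$ there is a Euclidean isometry $M_t$ of $\mathbb{R}^2$ with $M_t\rho_t(v)=\rho(v)$ for all $v\in V_G$. A framework (or realization) is flexible if it has a non-trivial flex, and rigid otherwise. A NAC-coloring of $G$ is a surjective map $\delta\colon E_G\to\{\text{red},\text{blue}\}$ such that every (finite) cycle of $G$ either has all its edges of the same color or contains at least two edges of each color. *)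

theory Defs
  imports "HOL-Analysis.Analysis"
begin

definition simple_graph :: "'a set \<Rightarrow> 'a set set \<Rightarrow> bool" where
  "simple_graph V E \<longleftrightarrow> (\<forall>e\<in>E. e \<subseteq> V \<and> card e = 2)"

definition graph_connected :: "'a set \<Rightarrow> 'a set set \<Rightarrow> bool" where
  "graph_connected V E \<longleftrightarrow> (\<forall>u\<in>V. \<forall>v\<in>V. (u, v) \<in> {(x, y). {x, y} \<in> E}\<^sup>*)"

text \<open>
  Realizations are total functions; only their values on the vertex set matter, and every
  condition below is relativised to it.
\<close>

definition realization :: "'a set set \<Rightarrow> ('a \<Rightarrow> real^2) \<Rightarrow> bool" where
  "realization E \<rho> \<longleftrightarrow> (\<forall>u v. {u, v} \<in> E \<longrightarrow> \<rho> u \<noteq> \<rho> v)"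

definition flex ::
  "'a set \<Rightarrow> 'a set set \<Rightarrow> ('a \<Rightarrow> real^2) \<Rightarrow> real \<Rightarrow> (real \<Rightarrow> 'a \<Rightarrow> real^2) \<Rightarrow> bool" where
  "flex V E \<rho> \<epsilon> \<rho>t \<longleftrightarrow>
     \<epsilon> > 0 \<and>
     (\<forall>t\<in>{0..<\<epsilon>}. realization E (\<rho>t t)) \<and>
     (\<forall>v\<in>V. continuous_on {0..<\<epsilon>} (\<lambda>t. \<rho>t t v)) \<and>
     (\<forall>v\<in>V. \<rho>t 0 v = \<rho> v) \<and>
     (\<forall>t\<in>{0..<\<epsilon>}. \<forall>u v. {u, v} \<in> E \<longrightarrow> norm (\<rho>t t u - \<rho>t t v) = norm (\<rho> u - \<rho> v))"

definition euclidean_isometry :: "(real^2 \<Rightarrow> real^2) \<Rightarrow> bool" where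
  "euclidean_isometry M \<longleftrightarrow> (\<forall>x y. dist (M x) (M y) = dist x y)"

definition trivial_flex ::
  "'a set \<Rightarrow> ('a \<Rightarrow> real^2) \<Rightarrow> real \<Rightarrow> (real \<Rightarrow> 'a \<Rightarrow> real^2) \<Rightarrow> bool" where
  "trivial_flex V \<rho> \<epsilon> \<rho>t \<longleftrightarrow>
     (\<forall>t\<in>{0..<\<epsilon>}. \<exists>M. euclidean_isometry M \<and> (\<forall>v\<in>V. M (\<rho>t t v) = \<rho> v))"

definition flexible :: "'a set \<Rightarrow> 'a set set \<Rightarrow> ('a \<Rightarrow> real^2) \<Rightarrow> bool" where
  "flexible V E \<rho> \<longleftrightarrow> (\<exists>\<epsilon> \<rho>t. flex V E \<rho> \<epsilon> \<rho>t \<and> \<not> trivial_flex V \<rho> \<epsilon> \<rho>t)"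

text \<open>A cycle is given by the list of its vertices; the closing edge joins the last to the first.\<close>

definition cycle_edges :: "'a list \<Rightarrow> 'a set set" where
  "cycle_edges vs = {{vs ! i, vs ! (Suc i mod length vs)} | i. i < length vs}"

definition graph_cycle :: "'a set set \<Rightarrow> 'a list \<Rightarrow> bool" where
  "graph_cycle E vs \<longleftrightarrow> 3 \<le> length vs \<and> distinct vs \<and> cycle_edges vs \<subseteq> E"

datatype color = Red | Blue

text \<open>A coloring is a total function on vertex sets; only its values on the edges matter.\<close>

definition NAC_coloring :: "'a set set \<Rightarrow> ('a set \<Rightarrow> color) \<Rightarrow> bool" where
  "NAC_coloring E \<delta> \<longleftrightarrow>
     \<delta> ` E = UNIV \<and>
     (\<forall>vs. graph_cycle E vs \<longrightarrow>
        (\<exists>c. \<forall>e\<in>cycle_edges vs. \<delta> e = c) \<or>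
        (\<forall>c. card {e \<in> cycle_edges vs. \<delta> e = c} \<ge> 2))"

end

(*
  From a NAC-coloring, number the red components by r(v) and the blue components by b(v); then
  v |-> r(v) (1,0) + b(v) (cos t, sin t) is a flex, since a red edge keeps r and changes b.

  Conversely, regard the plane as the complex numbers and divide by the direction of a fixed edge to
  stop rotations.  The edge directions W = f v - f u and their conjugates Z = g v - g u are functions
  of t, W Z is a nonzero constant on every edge, W = 1 on the fixed edge, and some W takes infinitely
  many values.  Hence that W lies in a proper ideal of the ring of its own polynomials, and by
  Zorn's lemma there are a ring A of functions and a proper ideal I of A containing this W such that
  on every edge W lies in I or Z lies in A.  Color an edge red if W lies in I.  Since W and Z sum to
  zero along a cycle, the only non-red edge of a cycle would be red, and the only red edge would have
  Z in A, so that the unit W Z would lie in I.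
*)

theory Submission
  imports Defs "HOL-Library.Function_Algebras"
begin

section \<open>Subrings with a proper ideal\<close>

text \<open>Ring and ideal are sets in one ambient ring, so pairs can be compared by inclusion and
  united along chains. A maximal pair takes the part of a valuation ring with its maximal
  ideal.\<close>

locale ideal_pair =
  fixes A I :: "'k::comm_ring_1 set"
  assumes one_mem: "1 \<in> A"
    and diff_mem: "a \<in> A \<Longrightarrow> b \<in> A \<Longrightarrow> a - b \<in> A"
    and mult_mem: "a \<in> A \<Longrightarrow> b \<in> A \<Longrightarrow> a * b \<in> A"
    and ideal_subset: "I \<subseteq> A"
    and ideal_zero: "0 \<in> I"
    and ideal_diff: "a \<in> I \<Longrightarrow> b \<in> I \<Longrightarrow> a - b \<in> I"
    and ideal_mult: "a \<in> I \<Longrightarrow> b \<in> A \<Longrightarrow> a * b \<in> I"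
    and one_notin_ideal: "1 \<notin> I"
begin

lemma ideal_minus: "a \<in> I \<Longrightarrow> - a \<in> I"
  using ideal_diff[OF ideal_zero, of a] by simp

lemma ideal_add: "a \<in> I \<Longrightarrow> b \<in> I \<Longrightarrow> a + b \<in> I"
  using ideal_diff[of a "- b"] ideal_minus by simp

lemma zero_mem: "0 \<in> A"
  using ideal_zero ideal_subset by blast

lemma add_mem: "a \<in> A \<Longrightarrow> b \<in> A \<Longrightarrow> a + b \<in> A"
  using diff_mem[OF _ diff_mem[OF zero_mem], of a b] by simp

lemma sum_mem: "(\<And>i. i \<in> S \<Longrightarrow> f i \<in> A) \<Longrightarrow> sum f S \<in> A"
  by (induction S rule: infinite_finite_induct) (auto simp: zero_mem add_mem)

end

section \<open>Polynomials with filtered coefficients\<close>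

text \<open>Evaluated at \<open>z\<close>, the constant sequence \<open>A\<close> yields the ring
  A[z], the constant sequence \<open>I\<close> the ideal generated by \<open>I\<close> in it, and
  the sequence I, A, A, ... the ideal generated by \<open>I\<close> and \<open>z\<close>.\<close>

definition polys_with :: "(nat \<Rightarrow> 'k::comm_ring_1 set) \<Rightarrow> 'k poly set" where
  "polys_with C = {p. \<forall>i. coeff p i \<in> C i}"

text \<open>Treats both ideals of A[z] at once. Monotonicity makes \<open>polys_with C\<close>
  absorb multiplication by polynomials over \<open>A\<close>; \<open>bottom\<close> lets constant
  terms be discarded modulo \<open>I\<close>.\<close>

locale ideal_filtration = ideal_pair A I for A I :: "'k::comm_ring_1 set" +
  fixes C :: "nat \<Rightarrow> 'k set"
  assumes bottom: "C 0 = I"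
    and filtration_mono: "mono C"
    and filtration_subset: "C i \<subseteq> A"
    and filtration_diff: "a \<in> C i \<Longrightarrow> b \<in> C i \<Longrightarrow> a - b \<in> C i"
    and filtration_mult: "a \<in> C i \<Longrightarrow> b \<in> A \<Longrightarrow> a * b \<in> C i"
begin

lemma ideal_subset_filtration: "I \<subseteq> C i"
  using bottom monoD[OF filtration_mono, of 0 i] by auto

lemma filtration_zero: "0 \<in> C i"
  using ideal_subset_filtration ideal_zero by auto

lemma filtration_add: "a \<in> C i \<Longrightarrow> b \<in> C i \<Longrightarrow> a + b \<in> C i"
  using filtration_diff[of a i "0 - b"] filtration_diff[OF filtration_zero, of b i] by simp

lemma filtration_sum: "(\<And>j. j \<in> S \<Longrightarrow> f j \<in> C i) \<Longrightarrow> sum f S \<in> C i"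
  by (induction S rule: infinite_finite_induct) (auto simp: filtration_zero filtration_add)

lemma polys_with_add: "p \<in> polys_with C \<Longrightarrow> q \<in> polys_with C \<Longrightarrow> p + q \<in> polys_with C"
  by (auto simp: polys_with_def filtration_add)

lemma polys_with_diff: "p \<in> polys_with C \<Longrightarrow> q \<in> polys_with C \<Longrightarrow> p - q \<in> polys_with C"
  by (auto simp: polys_with_def filtration_diff)

lemma polys_with_mult:
  assumes "p \<in> polys_with C" "q \<in> polys_with (\<lambda>_. A)"
  shows "p * q \<in> polys_with C"
  unfolding polys_with_def
proof safe
  fix k
  show "coeff (p * q) k \<in> C k"
    unfolding coeff_mult
  proof (rule filtration_sum)
    fix i assume "i \<in> {..k}"
    then have "C i \<subseteq> C k"
      using filtration_mono by (auto dest: monoD)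
    then show "coeff p i * coeff q (k - i) \<in> C k"
      using assms filtration_mult[of "coeff p i" i "coeff q (k - i)"]
      by (auto simp: polys_with_def)
  qed
qed

text \<open>The ring and ideal laws pass from polynomials to their values; only properness can fail.
  For a maximal pair that failure yields a relation with value 1.\<close>

lemma adjoin:
  assumes "1 \<notin> (\<lambda>p. poly p z) ` polys_with C"
  shows "ideal_pair ((\<lambda>p. poly p z) ` polys_with (\<lambda>_. A)) ((\<lambda>p. poly p z) ` polys_with C)"
proof
  show "1 \<in> (\<lambda>p. poly p z) ` polys_with (\<lambda>_. A)"
    by (rule image_eqI[of _ _ 1])
      (auto simp: polys_with_def coeff_1 one_mem zero_mem)
  show "(\<lambda>p. poly p z) ` polys_with C \<subseteq> (\<lambda>p. poly p z) ` polys_with (\<lambda>_. A)"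
    using filtration_subset by (fastforce simp: polys_with_def)
  show "0 \<in> (\<lambda>p. poly p z) ` polys_with C"
    by (rule image_eqI[of _ _ 0]) (auto simp: polys_with_def filtration_zero)
  show "1 \<notin> (\<lambda>p. poly p z) ` polys_with C"
    by fact
next
  fix a b assume "a \<in> (\<lambda>p. poly p z) ` polys_with (\<lambda>_. A)" "b \<in> (\<lambda>p. poly p z) ` polys_with (\<lambda>_. A)"
  then obtain p q where pq: "p \<in> polys_with (\<lambda>_. A)" "q \<in> polys_with (\<lambda>_. A)"
    "a = poly p z" "b = poly q z"
    by auto
  then show "a - b \<in> (\<lambda>p. poly p z) ` polys_with (\<lambda>_. A)"
    by (intro image_eqI[of _ _ "p - q"]) (auto simp: polys_with_def diff_mem)
  show "a * b \<in> (\<lambda>p. poly p z) ` polys_with (\<lambda>_. A)"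
    using pq by (intro image_eqI[of _ _ "p * q"]) (auto simp: polys_with_def coeff_mult sum_mem mult_mem)
next
  fix a b assume "a \<in> (\<lambda>p. poly p z) ` polys_with C" "b \<in> (\<lambda>p. poly p z) ` polys_with C"
  then obtain p q where "p \<in> polys_with C" "q \<in> polys_with C" "a = poly p z" "b = poly q z"
    by auto
  then show "a - b \<in> (\<lambda>p. poly p z) ` polys_with C"
    by (intro image_eqI[of _ _ "p - q"]) (simp_all add: polys_with_diff)
next
  fix a b assume "a \<in> (\<lambda>p. poly p z) ` polys_with C" "b \<in> (\<lambda>p. poly p z) ` polys_with (\<lambda>_. A)"
  then obtain p q where "p \<in> polys_with C" "q \<in> polys_with (\<lambda>_. A)" "a = poly p z" "b = poly q z"
    by auto
  then show "a * b \<in> (\<lambda>p. poly p z) ` polys_with C"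
    by (intro image_eqI[of _ _ "p * q"]) (simp_all add: polys_with_mult)
qed

end

lemma (in ideal_pair) one_diff_mult:
  assumes "1 - u \<in> I" "1 - w \<in> I"
  shows "1 - u * w \<in> I"
proof -
  have "1 - u * w = (1 - u) + (1 - w) - (1 - u) * (1 - w)"
    by (simp add: algebra_simps)
  then show ?thesis
    using assms ideal_add ideal_diff ideal_mult ideal_subset by (metis subsetD)
qed

text \<open>The relation of smaller degree in one of \<open>x\<close>, \<open>y = 1/x\<close> rewrites the leading power of the other;
  keeping values in \<open>1 + I\<close> instead of normalising them to \<open>1\<close> avoids division by elements of
  \<open>1 + I\<close>, which need not be invertible in the ambient ring.\<close>

lemma no_two_relations:
  fixes A I :: "'k::comm_ring_1 set"
  assumes "ideal_filtration A I C" "ideal_filtration A I D"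
    and "\<And>i j a b. a \<in> C i \<Longrightarrow> b \<in> D j \<Longrightarrow> a * b \<in> I"
    and "x * y = 1"
    and "p \<in> polys_with C" "1 - poly p y \<in> I"
    and "q \<in> polys_with D" "1 - poly q x \<in> I"
  shows False
  using assms
proof (induction "degree p + degree q" arbitrary: p q x y C D rule: less_induct)
  case less
  interpret C: ideal_filtration A I C by fact
  interpret D: ideal_filtration A I D by fact
  \<comment> \<open>Stated for arbitrary data because the case \<open>degree p < degree q\<close>
    uses it with \<open>p\<close>, \<open>y\<close>, \<open>C\<close> and \<open>q\<close>,
    \<open>x\<close>, \<open>D\<close> exchanged.\<close>
  have reduce: "\<exists>p'. p' \<in> polys_with C \<and> 1 - poly p' y \<in> I \<and> degree p' < degree p"
    if C: "ideal_filtration A I C" and D: "ideal_filtration A I D"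
      and prod: "\<And>i j a b. a \<in> C i \<Longrightarrow> b \<in> D j \<Longrightarrow> a * b \<in> I"
      and xy: "x * y = 1"
      and p: "p \<in> polys_with C" "1 - poly p y \<in> I"
      and q: "q \<in> polys_with D" "1 - poly q x \<in> I"
      and le: "degree q \<le> degree p"
    for p q :: "'k poly" and x y C D
  proof -
    interpret C: ideal_filtration A I C by fact
    interpret D: ideal_filtration A I D by fact
    define m n where "m = degree q" and "n = degree p"
    \<comment> \<open>The value of a constant \<open>q\<close> would be its constant term, an
      element of \<open>I\<close>, although it also lies in 1 + I.\<close>
    have pos: "m > 0"
    proof (rule ccontr)
      assume "\<not> m > 0"
      then have "poly q x = coeff q 0"
        by (metis degree_eq_zeroE gr0I m_def mult_zero_right add.right_neutral poly_pCons poly_0 coeff_pCons_0)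
      moreover have "coeff q 0 \<in> I"
        using q D.bottom by (auto simp: polys_with_def)
      ultimately have "1 \<in> I"
        using q(2) C.ideal_add by fastforce
      then show False
        using C.one_notin_ideal by simp
    qed
    \<comment> \<open>Dropping the constant term keeps the value in 1 + I and leaves only positive
      powers of \<open>x\<close>, each of which lowers the exponent of \<open>y ^ n\<close>.\<close>
    define w where "w = poly q x - coeff q 0"
    have q0: "coeff q 0 \<in> I"
      using q D.bottom by (auto simp: polys_with_def)
    have w1: "1 - w \<in> I"
      using C.ideal_add[OF q(2) q0] by (simp add: w_def algebra_simps)
    have "1 - (1 - w) \<in> A"
      using w1 C.one_mem C.diff_mem C.ideal_subset by blast
    then have wA: "w \<in> A"
      by simp
    have w: "w = (\<Sum>j=1..m. coeff q j * x ^ j)"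
    proof -
      have "poly q x = (\<Sum>j\<le>m. coeff q j * x ^ j)"
        by (simp add: poly_altdef m_def)
      also have "{..m} = insert 0 {1..m}"
        by auto
      finally show ?thesis
        by (simp add: w_def)
    qed
    have wy: "w * y ^ n = (\<Sum>j=1..m. coeff q j * y ^ (n - j))"
    proof -
      have "x ^ j * y ^ n = y ^ (n - j)" if "j \<in> {1..m}" for j
      proof -
        have "y ^ n = y ^ j * y ^ (n - j)"
          using that le by (simp add: m_def n_def flip: power_add)
        then have "x ^ j * y ^ n = (x * y) ^ j * y ^ (n - j)"
          by (simp add: power_mult_distrib mult.assoc)
        then show ?thesis
          by (simp add: xy)
      qed
      then show ?thesis
        unfolding w sum_distrib_right by (intro sum.cong) (simp_all add: mult.assoc)
    qed
    define a where "a = coeff p n"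
    define r where "r = (\<Sum>j=1..m. monom (a * coeff q j) (n - j))"
    \<comment> \<open>Multiply the relation by \<open>w\<close> and rewrite its leading term
      \<open>a * w * y ^ n\<close> in lower powers of \<open>y\<close>. The value becomes
      \<open>poly p y * w\<close>, again in 1 + I.\<close>
    define p' where "p' = smult w (p - monom a n) + r"
    have "poly p' y = w * (poly p y - a * y ^ n) + (\<Sum>j=1..m. a * coeff q j * y ^ (n - j))"
      by (simp add: p'_def r_def poly_sum poly_monom)
    also have "(\<Sum>j=1..m. a * coeff q j * y ^ (n - j)) = a * (w * y ^ n)"
      by (simp add: wy sum_distrib_left mult.assoc)
    also have "w * (poly p y - a * y ^ n) + \<dots> = poly p y * w"
      by (simp add: algebra_simps)
    finally have value_in: "1 - poly p' y \<in> I"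
      using C.one_diff_mult p(2) w1 by simp
    \<comment> \<open>The new coefficients lie in \<open>I\<close> by \<open>prod\<close>, hence are
      admissible in every degree, wherever the rewriting puts them.\<close>
    have "a * coeff q j \<in> C k" for j k
      using p(1) q(1) prod[of a n "coeff q j" j] C.ideal_subset_filtration
      by (auto simp: polys_with_def a_def)
    then have "r \<in> polys_with C"
      using C.filtration_zero unfolding polys_with_def r_def
      by (auto simp: coeff_sum coeff_monom intro!: C.filtration_sum)
    moreover have "smult w (p - monom a n) \<in> polys_with C"
      using p(1) C.filtration_mult[OF _ wA] C.filtration_zero
      unfolding polys_with_def a_def by (auto simp: coeff_monom mult.commute[of w])
    ultimately have coeffs: "p' \<in> polys_with C"
      unfolding p'_def by (rule C.polys_with_add[rotated])
    have "degree p' \<le> n - 1"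
    proof (rule degree_le, safe)
      fix i assume "n - 1 < i"
      moreover have "coeff r i = 0" if "n \<le> i"
        unfolding r_def coeff_sum using that pos le
        by (intro sum.neutral) (auto simp: coeff_monom m_def n_def)
      moreover have "coeff p i = 0" if "n < i"
        using that by (simp add: n_def coeff_eq_0)
      ultimately show "coeff p' i = 0"
        using pos by (cases "i = n") (auto simp: p'_def a_def coeff_monom)
    qed
    then show ?thesis
      using value_in coeffs pos le by (intro exI[of _ p']) (auto simp: m_def n_def)
  qed
  show False
  proof (cases "degree q \<le> degree p")
    case True
    then obtain p' where "p' \<in> polys_with C" "1 - poly p' y \<in> I" "degree p' < degree p"
      using reduce[of C D x y p q] less.prems by auto
    then show False
      using less.hyps[of p' q C D x y] less.prems by auto
  next
    case False
    have "a * b \<in> I" if "a \<in> D i" "b \<in> C j" for a b i j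
      using less.prems(3) that by (metis mult.commute)
    moreover have "y * x = 1"
      using less.prems(4) by (simp add: mult.commute)
    ultimately obtain q' where "q' \<in> polys_with D" "1 - poly q' x \<in> I" "degree q' < degree q"
      using reduce[of D C y x q p] less.prems False by auto
    then show False
      using less.hyps[of p q' C D x y] less.prems by auto
  qed
qed

section \<open>Maximal pairs and Zorn's lemma\<close>

text \<open>If both alternatives fail, adjoining \<open>y\<close> to the ring, or \<open>x\<close>
  to the ideal, would give a strictly larger pair unless the extended ideal contains 1. So 1 is a
  polynomial in \<open>y\<close> over \<open>I\<close> and also one in \<open>x\<close> with
  constant term in \<open>I\<close>, which \<open>no_two_relations\<close> excludes.\<close>

lemma maximal_ideal_pair_dichotomy:
  fixes A I :: "'k::comm_ring_1 set"
  assumes pair: "ideal_pair A I"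
    and maximal: "\<And>A' I'. ideal_pair A' I' \<Longrightarrow> A \<subseteq> A' \<Longrightarrow> I \<subseteq> I' \<Longrightarrow> A' = A \<and> I' = I"
    and xy: "x * y = 1"
  shows "x \<in> I \<or> y \<in> A"
proof (rule ccontr)
  assume neither: "\<not> (x \<in> I \<or> y \<in> A)"
  interpret ideal_pair A I by fact
  \<comment> \<open>\<open>C\<close> extends the ideal only by what \<open>I\<close> generates in
    A[y]; \<open>D\<close> also puts \<open>x\<close> itself into the ideal. Coefficient products
    lie in \<open>I\<close> because \<open>I\<close> absorbs \<open>A\<close>.\<close>
  define C where "C = (\<lambda>_::nat. I)"
  define D where "D = (\<lambda>i::nat. if i = 0 then I else A)"
  interpret C: ideal_filtration A I C
    by unfold_locales (use ideal_subset ideal_diff ideal_mult in \<open>auto simp: C_def mono_def\<close>)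
  interpret D: ideal_filtration A I D
    by unfold_locales
      (use ideal_subset ideal_diff ideal_mult diff_mem mult_mem in \<open>auto simp: D_def mono_def split: if_splits\<close>)
  have const: "a \<in> (\<lambda>p. poly p z) ` polys_with F"
    if "a \<in> F 0" "\<And>i. 0 \<in> F i" for a z and F :: "nat \<Rightarrow> 'k set"
    using that by (intro image_eqI[of _ _ "[:a:]"]) (auto simp: polys_with_def coeff_pCons split: nat.splits)
  have var: "z \<in> (\<lambda>p. poly p z) ` polys_with F"
    if "1 \<in> F 1" "\<And>i. 0 \<in> F i" for z and F :: "nat \<Rightarrow> 'k set"
    using that by (intro image_eqI[of _ _ "[:0, 1:]"]) (auto simp: polys_with_def coeff_pCons split: nat.splits)
  have "1 \<in> (\<lambda>p. poly p y) ` polys_with C"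
  proof (rule ccontr)
    assume "1 \<notin> (\<lambda>p. poly p y) ` polys_with C"
    from C.adjoin[OF this] have "(\<lambda>p. poly p y) ` polys_with (\<lambda>_. A) = A"
      by (intro maximal[THEN conjunct1]) (auto intro!: const simp: zero_mem ideal_zero C_def)
    then show False
      using var[of "\<lambda>_. A" y] neither one_mem zero_mem by auto
  qed
  moreover have "1 \<in> (\<lambda>p. poly p x) ` polys_with D"
  proof (rule ccontr)
    assume "1 \<notin> (\<lambda>p. poly p x) ` polys_with D"
    from D.adjoin[OF this] have "(\<lambda>p. poly p x) ` polys_with D = I"
      by (intro maximal[THEN conjunct2])
        (auto intro!: const simp: zero_mem ideal_zero D_def)
    then show False
      using var[of D x] neither one_mem zero_mem ideal_zero by (auto simp: D_def)
  qed
  ultimately obtain p q where "p \<in> polys_with C" "poly p y = 1" "q \<in> polys_with D" "poly q x = 1"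
    by (metis (no_types, lifting) imageE)
  moreover have "a * b \<in> I" if "a \<in> C i" "b \<in> D j" for a b i j
    using that ideal_mult ideal_subset by (auto simp: C_def D_def split: if_splits)
  ultimately show False
    using no_two_relations[OF C.ideal_filtration_axioms D.ideal_filtration_axioms _ xy, of p q]
    by (simp add: ideal_zero)
qed

text \<open>A form of Chevalley's extension theorem for places that needs no field: the ambient ring is
  arbitrary and the valuation property is only claimed for its units.\<close>

theorem ideal_pair_extension:
  fixes A I :: "'k::comm_ring_1 set"
  assumes "ideal_pair A I"
  obtains A' I' where "ideal_pair A' I'" "A \<subseteq> A'" "I \<subseteq> I'"
    "\<And>x y. x * y = 1 \<Longrightarrow> x \<in> I' \<or> y \<in> A'"
proof -
  \<comment> \<open>A pair is coded as one subset of the disjoint sum, so that componentwise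
    inclusion becomes inclusion and the subset form of Zorn's lemma applies.\<close>
  define P where
    "P = {X :: ('k + 'k) set. ideal_pair (Inl -` X) (Inr -` X) \<and> A \<subseteq> Inl -` X \<and> I \<subseteq> Inr -` X}"
  have vimage_Plus [simp]: "Inl -` (B <+> J) = B" "Inr -` (B <+> J) = J" for B J :: "'k set"
    by auto
  have "A <+> I \<in> P"
    using assms by (simp add: P_def)
  then have "P \<noteq> {}"
    by blast
  moreover have "\<Union>\<C> \<in> P" if "\<C> \<noteq> {}" and chain: "subset.chain P \<C>" for \<C>
  proof -
    have pair: "ideal_pair (Inl -` X) (Inr -` X)" and above: "A \<subseteq> Inl -` X" "I \<subseteq> Inr -` X"
      if "X \<in> \<C>" for X
      using that chain by (auto simp: P_def subset_chain_def)
    \<comment> \<open>Any two elements of the union lie in one member of the chain, where the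
      closure laws can be applied.\<close>
    have common: "\<exists>Z\<in>\<C>. a \<in> Z \<and> b \<in> Z" if ab: "a \<in> \<Union>\<C>" "b \<in> \<Union>\<C>" for a b
    proof -
      obtain X Y where "X \<in> \<C>" "Y \<in> \<C>" "a \<in> X" "b \<in> Y"
        using ab by blast
      moreover from this have "X \<subseteq> Y \<or> Y \<subseteq> X"
        using chain by (simp add: subset_chain_def)
      ultimately show ?thesis
        by (elim disjE) blast+
    qed
    obtain X0 where X0: "X0 \<in> \<C>"
      using \<open>\<C> \<noteq> {}\<close> by blast
    have "ideal_pair (Inl -` \<Union>\<C>) (Inr -` \<Union>\<C>)"
    proof
      show "1 \<in> Inl -` \<Union>\<C>" "0 \<in> Inr -` \<Union>\<C>"
        using X0 ideal_pair.one_mem[OF pair[OF X0]] ideal_pair.ideal_zero[OF pair[OF X0]] by auto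
      show "Inr -` \<Union>\<C> \<subseteq> Inl -` \<Union>\<C>"
        using ideal_pair.ideal_subset[OF pair] by fastforce
      show "1 \<notin> Inr -` \<Union>\<C>"
        using ideal_pair.one_notin_ideal[OF pair] by auto
    next
      fix a b assume "a \<in> Inl -` \<Union>\<C>" "b \<in> Inl -` \<Union>\<C>"
      then obtain Z where "Z \<in> \<C>" "Inl a \<in> Z" "Inl b \<in> Z"
        using common[of "Inl a" "Inl b"] by auto
      then show "a - b \<in> Inl -` \<Union>\<C>" "a * b \<in> Inl -` \<Union>\<C>"
        using ideal_pair.diff_mem[OF pair, of Z a b] ideal_pair.mult_mem[OF pair, of Z a b] by auto
    next
      fix a b assume "a \<in> Inr -` \<Union>\<C>" "b \<in> Inr -` \<Union>\<C>"
      then obtain Z where "Z \<in> \<C>" "Inr a \<in> Z" "Inr b \<in> Z"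
        using common[of "Inr a" "Inr b"] by auto
      then show "a - b \<in> Inr -` \<Union>\<C>"
        using ideal_pair.ideal_diff[OF pair, of Z a b] by auto
    next
      fix a b assume "a \<in> Inr -` \<Union>\<C>" "b \<in> Inl -` \<Union>\<C>"
      then obtain Z where "Z \<in> \<C>" "Inr a \<in> Z" "Inl b \<in> Z"
        using common[of "Inr a" "Inl b"] by auto
      then show "a * b \<in> Inr -` \<Union>\<C>"
        using ideal_pair.ideal_mult[OF pair, of Z a b] by auto
    qed
    then show ?thesis
      using above[OF X0] X0 by (auto simp: P_def)
  qed
  ultimately have "\<exists>M\<in>P. \<forall>X\<in>P. M \<subseteq> X \<longrightarrow> X = M"
    by (rule subset_Zorn_nonempty)
  then obtain M where M: "M \<in> P" "\<And>X. X \<in> P \<Longrightarrow> M \<subseteq> X \<Longrightarrow> X = M"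
    by blast
  define A' I' where "A' = Inl -` M" and "I' = Inr -` M"
  have pair: "ideal_pair A' I'" and above: "A \<subseteq> A'" "I \<subseteq> I'"
    using M(1) by (auto simp: P_def A'_def I'_def)
  have "B = A' \<and> J = I'" if "ideal_pair B J" "A' \<subseteq> B" "I' \<subseteq> J" for B J
  proof -
    have "M \<subseteq> B <+> J"
    proof
      fix z assume "z \<in> M"
      then show "z \<in> B <+> J"
        using that by (cases z) (auto simp: A'_def I'_def)
    qed
    moreover have "B <+> J \<in> P"
      using that above by (auto simp: P_def)
    ultimately have "B <+> J = M"
      by (rule M(2)[rotated])
    then show ?thesis
      by (auto simp: A'_def I'_def)
  qed
  then show thesis
    using that[OF pair above] maximal_ideal_pair_dichotomy[OF pair] by blast
qed

section \<open>Flexes from NAC-colorings\<close>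

text \<open>Distinctness is what lets an added edge close the path to a \<open>graph_cycle\<close>.
  A step back to an earlier vertex is handled by cutting the path there.\<close>

lemma rtrancl_distinct_path:
  assumes "(u, v) \<in> R\<^sup>*"
  obtains vs where "distinct vs" "vs \<noteq> []" "hd vs = u" "last vs = v"
    "successively (\<lambda>x y. (x, y) \<in> R) vs"
proof -
  have "\<exists>vs. distinct vs \<and> vs \<noteq> [] \<and> hd vs = u \<and> last vs = v \<and> successively (\<lambda>x y. (x, y) \<in> R) vs"
    using assms
  proof induction
    case base
    show ?case
      by (intro exI[of _ "[u]"]) simp
  next
    case (step y z)
    then obtain vs where vs: "distinct vs" "vs \<noteq> []" "hd vs = u" "last vs = y"
      "successively (\<lambda>x y. (x, y) \<in> R) vs"
      by blast
    show ?case
    proof (cases "z \<in> set vs")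
      case True
      then obtain xs ys where "vs = xs @ z # ys"
        by (meson split_list)
      with vs show ?thesis
        by (intro exI[of _ "xs @ [z]"]) (auto simp: successively_append_iff hd_append)
    next
      case False
      with vs step.hyps show ?thesis
        by (intro exI[of _ "vs @ [z]"]) (auto simp: successively_append_iff)
    qed
  qed
  then show thesis
    using that by blast
qed

section \<open>Monochromatic components\<close>

definition color_graph :: "'a set set \<Rightarrow> ('a set \<Rightarrow> color) \<Rightarrow> color \<Rightarrow> ('a \<times> 'a) set" where
  "color_graph E \<delta> c = {(x, y). {x, y} \<in> E \<and> \<delta> {x, y} = c}"

lemma sym_color_graph: "sym (color_graph E \<delta> c)"
  by (auto simp: color_graph_def sym_def insert_commute)

text \<open>A path of color \<open>c\<close> closed by the edge \<open>{u, v}\<close> would be a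
  cycle with exactly one edge of the other color.\<close>

lemma NAC_coloring_no_detour:
  assumes NAC: "NAC_coloring E \<delta>" and uv: "{u, v} \<in> E" "u \<noteq> v" "\<delta> {u, v} \<noteq> c"
  shows "(u, v) \<notin> (color_graph E \<delta> c)\<^sup>*"
proof
  assume "(u, v) \<in> (color_graph E \<delta> c)\<^sup>*"
  then obtain vs where vs: "distinct vs" "vs \<noteq> []" "hd vs = u" "last vs = v"
    and path: "successively (\<lambda>x y. (x, y) \<in> color_graph E \<delta> c) vs"
    by (rule rtrancl_distinct_path)
  define n where "n = length vs"
  have step: "{vs ! i, vs ! Suc i} \<in> E \<and> \<delta> {vs ! i, vs ! Suc i} = c" if "Suc i < n" for i
    using successively_nth[OF path] that by (simp add: n_def color_graph_def)
  have u: "vs ! 0 = u" and v: "vs ! (n - 1) = v"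
    using vs by (simp_all add: hd_conv_nth last_conv_nth n_def)
  \<comment> \<open>One vertex would give \<open>u = v\<close>; two would make \<open>{u, v}\<close>
    itself an edge of color \<open>c\<close>.\<close>
  have n: "n \<ge> 3"
  proof (rule ccontr)
    assume "\<not> n \<ge> 3"
    then have "n = 0 \<or> n = 1 \<or> n = 2"
      by linarith
    then show False
      using step[of 0] u v uv vs(2) by (auto simp: n_def)
  qed
  \<comment> \<open>At the last index the successor wraps around to 0, which gives the closing
    edge.\<close>
  have edges: "{vs ! i, vs ! (Suc i mod n)} = (if Suc i < n then {vs ! i, vs ! Suc i} else {u, v})"
    if "i < n" for i
  proof (cases "Suc i < n")
    case False
    then have "i = n - 1" "Suc i = n"
      using that by auto
    then show ?thesis
      using u v False by (simp add: insert_commute)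
  qed simp
  have "cycle_edges vs = (\<lambda>i. {vs ! i, vs ! (Suc i mod n)}) ` {..<n}"
    by (auto simp: cycle_edges_def n_def)
  also have "\<dots> = (\<lambda>i. if Suc i < n then {vs ! i, vs ! Suc i} else {u, v}) ` {..<n}"
    using edges by (intro image_cong) simp_all
  finally have cycle: "cycle_edges vs = \<dots>" .
  have subset: "cycle_edges vs \<subseteq> E"
    using step uv(1) by (auto simp: cycle)
  have only: "e = {u, v}" if "e \<in> cycle_edges vs" "\<delta> e \<noteq> c" for e
    using that step by (auto simp: cycle split: if_splits)
  have first: "{vs ! 0, vs ! Suc 0} \<in> cycle_edges vs"
    unfolding cycle using n by (intro image_eqI[of _ _ 0]) simp_all
  have closing: "{u, v} \<in> cycle_edges vs"
    unfolding cycle using n by (intro image_eqI[of _ _ "n - 1"]) simp_all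
  have "graph_cycle E vs"
    using n vs(1) subset by (simp add: graph_cycle_def n_def)
  moreover have "\<not> (\<exists>c. \<forall>e\<in>cycle_edges vs. \<delta> e = c)"
    using first closing step[of 0] n uv(3) by fastforce
  ultimately have "card {e \<in> cycle_edges vs. \<delta> e = \<delta> {u, v}} \<ge> 2"
    using NAC by (auto simp: NAC_coloring_def)
  moreover have "{e \<in> cycle_edges vs. \<delta> e = \<delta> {u, v}} = {{u, v}}"
  proof (intro equalityI subsetI)
    fix e assume "e \<in> {e \<in> cycle_edges vs. \<delta> e = \<delta> {u, v}}"
    then have "e = {u, v}"
      using uv(3) by (intro only) simp_all
    then show "e \<in> {{u, v}}"
      by blast
  qed (use closing in blast)
  ultimately show False
    by simp
qed

text \<open>Countability of the graph enters only here.\<close>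

lemma component_labelling:
  assumes "countable V" "sym R" "R \<subseteq> V \<times> V"
  obtains f :: "'a \<Rightarrow> nat"
  where "\<And>u v. u \<in> V \<Longrightarrow> v \<in> V \<Longrightarrow> f u = f v \<longleftrightarrow> (u, v) \<in> R\<^sup>*"
proof
  \<comment> \<open>The predicate under \<open>SOME\<close> is the same for all vertices of a
    component, so the choice depends on the component only.\<close>
  define r where "r v = (SOME w. (v, w) \<in> R\<^sup>*)" for v
  have r: "(v, r v) \<in> R\<^sup>*" for v
    unfolding r_def by (rule someI[of _ v]) simp
  have sym: "sym (R\<^sup>*)"
    using assms(2) by (rule sym_rtrancl)
  \<comment> \<open>\<open>to_nat_on V\<close> is injective on \<open>V\<close> only, so the
    representatives must stay in \<open>V\<close>.\<close>
  have r_mem: "r v \<in> V" if "v \<in> V" for v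
    using r[of v] that assms(3) by (induction rule: rtrancl_induct) auto
  fix u v assume "u \<in> V" "v \<in> V"
  then have "to_nat_on V (r u) = to_nat_on V (r v) \<longleftrightarrow> r u = r v"
    using r_mem assms(1) by simp
  also have "r u = r v \<longleftrightarrow> (u, v) \<in> R\<^sup>*"
  proof
    assume "r u = r v"
    then show "(u, v) \<in> R\<^sup>*"
      using r[of u] r[of v] sym by (metis rtrancl_trans symD)
  next
    assume "(u, v) \<in> R\<^sup>*"
    then have "(u, w) \<in> R\<^sup>* \<longleftrightarrow> (v, w) \<in> R\<^sup>*" for w
      using sym by (meson rtrancl_trans symD)
    then show "r u = r v"
      by (simp add: r_def)
  qed
  finally show "to_nat_on V (r u) = to_nat_on V (r v) \<longleftrightarrow> (u, v) \<in> R\<^sup>*" .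
qed

section \<open>The flex with rotating red edges\<close>

text \<open>Polarisation writes the inner product through four distances, so no linear form of
  \<open>M\<close> is needed. The inner product of a red and a blue edge vector thus becomes an
  invariant that detects non-triviality.\<close>

lemma euclidean_isometry_inner_diff:
  assumes "euclidean_isometry M"
  shows "(M a - M b) \<bullet> (M c - M d) = (a - b) \<bullet> (c - d)"
proof -
  have polar: "(a - b) \<bullet> (c - d) = ((dist a d)\<^sup>2 + (dist b c)\<^sup>2 - (dist a c)\<^sup>2 - (dist b d)\<^sup>2) / 2"
    for a b c d :: "real^2"
    by (simp add: dist_norm power2_norm_eq_inner inner_diff_left inner_diff_right inner_commute field_simps)
  show ?thesis
    using assms by (simp add: polar euclidean_isometry_def)
qed

lemma NAC_coloring_imp_flexible:
  fixes V :: "'a set"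
  assumes "simple_graph V E" "countable V" and NAC: "NAC_coloring E \<delta>"
  shows "\<exists>\<rho>. realization E \<rho> \<and> flexible V E \<rho>"
proof -
  have edge: "u \<in> V" "v \<in> V" "u \<noteq> v" if "{u, v} \<in> E" for u v
    using assms(1) that by (auto simp: simple_graph_def card_insert_if split: if_splits)
  have "color_graph E \<delta> c \<subseteq> V \<times> V" for c
    using edge by (auto simp: color_graph_def)
  then have "\<exists>f :: 'a \<Rightarrow> nat. \<forall>u\<in>V. \<forall>v\<in>V. f u = f v \<longleftrightarrow> (u, v) \<in> (color_graph E \<delta> c)\<^sup>*" for c
    using component_labelling[OF assms(2) sym_color_graph] by metis
  then obtain L :: "color \<Rightarrow> 'a \<Rightarrow> nat"
    where L: "\<And>c u v. u \<in> V \<Longrightarrow> v \<in> V \<Longrightarrow> L c u = L c v \<longleftrightarrow> (u, v) \<in> (color_graph E \<delta> c)\<^sup>*"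
    by metis
  \<comment> \<open>Each edge lies inside a component of its own color and, by
    \<open>NAC_coloring_no_detour\<close>, joins two different components of the other
    color.\<close>
  have label: "L c u = L c v \<longleftrightarrow> \<delta> {u, v} = c" if "{u, v} \<in> E" for c u v
  proof
    assume "L c u = L c v"
    then show "\<delta> {u, v} = c"
      using L edge that NAC_coloring_no_detour[OF NAC] by blast
  next
    assume "\<delta> {u, v} = c"
    then have "(u, v) \<in> color_graph E \<delta> c"
      using that by (simp add: color_graph_def)
    then show "L c u = L c v"
      using L edge that by blast
  qed
  define e :: "real \<Rightarrow> real^2" where "e t = cos t *\<^sub>R axis 1 1 + sin t *\<^sub>R axis 2 1" for t
  have inner_e: "e s \<bullet> e t = cos s * cos t + sin s * sin t" for s t
    by (simp add: e_def inner_add_left inner_add_right inner_axis_axis)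
  have norm_e: "norm (e t) = 1" for t
    by (simp add: norm_eq_sqrt_inner inner_e flip: power2_eq_square)
  have e_nonzero: "e t \<noteq> 0" for t
    using norm_e[of t] by auto
  have cont_e: "continuous_on S e" for S
    unfolding e_def by (intro continuous_intros)
  define \<rho>t where "\<rho>t t v = real (L Red v) *\<^sub>R e 0 + real (L Blue v) *\<^sub>R e t" for t v
  have diff: "\<rho>t t u - \<rho>t t v =
      (real (L Red u) - real (L Red v)) *\<^sub>R e 0 + (real (L Blue u) - real (L Blue v)) *\<^sub>R e t" for t u v
    by (simp add: \<rho>t_def algebra_simps)
  have red: "\<rho>t t u - \<rho>t t v = (real (L Blue u) - real (L Blue v)) *\<^sub>R e t"
    and red_ne: "L Blue u \<noteq> L Blue v"
    if "{u, v} \<in> E" "\<delta> {u, v} = Red" for t u v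
    using that label by (simp_all add: diff)
  have blue: "\<rho>t t u - \<rho>t t v = (real (L Red u) - real (L Red v)) *\<^sub>R e 0"
    and blue_ne: "L Red u \<noteq> L Red v"
    if "{u, v} \<in> E" "\<delta> {u, v} = Blue" for t u v
    using that label by (simp_all add: diff)
  \<comment> \<open>On each edge exactly one of the two terms survives, so no \<open>t\<close> has
    to be avoided, even where \<open>e t\<close> and \<open>e 0\<close> are parallel.\<close>
  have realization: "realization E (\<rho>t t)" for t
    unfolding realization_def
  proof (intro allI impI)
    fix u v assume uv: "{u, v} \<in> E"
    have "\<rho>t t u - \<rho>t t v \<noteq> 0"
      using red[OF uv] red_ne[OF uv] blue[OF uv] blue_ne[OF uv] e_nonzero
      by (cases "\<delta> {u, v}") auto
    then show "\<rho>t t u \<noteq> \<rho>t t v"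
      by simp
  qed
  have norms: "norm (\<rho>t t u - \<rho>t t v) = norm (\<rho>t 0 u - \<rho>t 0 v)" if "{u, v} \<in> E" for t u v
    using red[OF that] blue[OF that] norm_e by (cases "\<delta> {u, v}") auto
  \<comment> \<open>The bound 4 only has to exceed pi: there \<open>e t\<close> is opposite to
    \<open>e 0\<close>, and the inner product of a red and a blue edge vector has changed
    sign.\<close>
  have "flex V E (\<rho>t 0) 4 \<rho>t"
    unfolding flex_def
  proof (intro conjI ballI allI impI)
    show "continuous_on {0..<4} (\<lambda>t. \<rho>t t v)" for v
      unfolding \<rho>t_def by (intro continuous_intros cont_e)
  qed (auto intro: realization norms)
  moreover have "\<not> trivial_flex V (\<rho>t 0) 4 \<rho>t"
  proof
    assume "trivial_flex V (\<rho>t 0) 4 \<rho>t"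
    moreover have "pi \<in> {0..<4}"
      using pi_less_4 by simp
    ultimately obtain M where M: "euclidean_isometry M" "\<And>v. v \<in> V \<Longrightarrow> M (\<rho>t pi v) = \<rho>t 0 v"
      unfolding trivial_flex_def by blast
    have "\<exists>u v. {u, v} \<in> E \<and> \<delta> {u, v} = c" for c
    proof -
      have "c \<in> \<delta> ` E"
        using NAC by (simp add: NAC_coloring_def)
      then show ?thesis
        using assms(1) by (auto simp: simple_graph_def card_2_iff) metis
    qed
    then obtain a b c d where ab: "{a, b} \<in> E" "\<delta> {a, b} = Red" and cd: "{c, d} \<in> E" "\<delta> {c, d} = Blue"
      by metis
    have "(\<rho>t 0 a - \<rho>t 0 b) \<bullet> (\<rho>t 0 c - \<rho>t 0 d) = (\<rho>t pi a - \<rho>t pi b) \<bullet> (\<rho>t pi c - \<rho>t pi d)"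
      using euclidean_isometry_inner_diff[OF M(1), of "\<rho>t pi a" "\<rho>t pi b" "\<rho>t pi c" "\<rho>t pi d"]
        M(2) edge ab cd by simp
    then show False
      using red_ne[OF ab] blue_ne[OF cd] by (simp add: red[OF ab] blue[OF cd] inner_e)
  qed
  ultimately show ?thesis
    using realization by (auto simp: flexible_def)
qed

section \<open>NAC-colorings from flexes\<close>

text \<open>The differences around a closed walk sum to zero, so each is minus the sum of the
  others. \<open>J\<close> will be the ring for \<open>g\<close> and the ideal for
  \<open>f\<close>.\<close>

lemma cycle_diff_mem:
  fixes h :: "'a \<Rightarrow> 'k::ab_group_add"
  assumes J: "0 \<in> J" "\<And>a b. a \<in> J \<Longrightarrow> b \<in> J \<Longrightarrow> a - b \<in> J"
    and i: "i < length vs"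
    and others: "\<And>j. j < length vs \<Longrightarrow> j \<noteq> i \<Longrightarrow> h (vs ! (Suc j mod length vs)) - h (vs ! j) \<in> J"
  shows "h (vs ! (Suc i mod length vs)) - h (vs ! i) \<in> J"
proof -
  define n where "n = length vs"
  define d where "d j = h (vs ! (Suc j mod n)) - h (vs ! j)" for j
  obtain m where m: "n = Suc m"
    using i by (cases n) (auto simp: n_def)
  have "(\<Sum>j<n. h (vs ! (Suc j mod n))) = (\<Sum>j<m. h (vs ! Suc j)) + h (vs ! 0)"
    by (simp add: m)
  also have "\<dots> = (\<Sum>j<n. h (vs ! j))"
    unfolding m by (simp only: sum.lessThan_Suc_shift add.commute)
  finally have "(\<Sum>j<n. d j) = 0"
    by (simp add: d_def sum_subtractf)
  moreover have "(\<Sum>j<n. d j) = d i + (\<Sum>j\<in>{..<n} - {i}. d j)"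
    using i by (intro sum.remove) (auto simp: n_def)
  ultimately have "d i = 0 - (\<Sum>j\<in>{..<n} - {i}. d j)"
    by (simp add: eq_neg_iff_add_eq_0)
  moreover have "(\<Sum>j\<in>{..<n} - {i}. d j) \<in> J"
  proof -
    have "sum d S \<in> J" if "\<And>j. j \<in> S \<Longrightarrow> d j \<in> J" for S
      using that
    proof (induction S rule: infinite_finite_induct)
      case (insert j S)
      then have "d j - (0 - sum d S) \<in> J"
        by (intro J) auto
      then show ?case
        using insert by simp
    qed (auto intro: J)
    from this[of "{..<n} - {i}"] show ?thesis
      using others by (auto simp: d_def n_def)
  qed
  ultimately show ?thesis
    using J by (metis d_def n_def)
qed

text \<open>Two indices with the same edge would be cyclic successors of each other, impossible with
  at least three vertices. Hence a color with a single edge occurs at a single index.\<close>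

lemma cycle_edge_inj:
  assumes "graph_cycle E vs" "i < length vs" "j < length vs"
    and "{vs ! i, vs ! (Suc i mod length vs)} = {vs ! j, vs ! (Suc j mod length vs)}"
  shows "i = j"
proof (rule ccontr)
  assume "i \<noteq> j"
  define n where "n = length vs"
  have n: "n \<ge> 3" "i < n" "j < n" and "distinct vs"
    using assms by (auto simp: graph_cycle_def n_def)
  then have "vs ! i = vs ! (Suc j mod n)" "vs ! j = vs ! (Suc i mod n)"
    using assms(4) \<open>i \<noteq> j\<close> by (auto simp: doubleton_eq_iff nth_eq_iff_index_eq n_def)
  then have "i = Suc j mod n" "j = Suc i mod n"
    using n nth_eq_iff_index_eq[OF \<open>distinct vs\<close>, folded n_def] mod_less_divisor[of n]
    by (metis gr_zeroI not_less_zero)+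
  moreover have "Suc k = n \<and> Suc k mod n = 0 \<or> Suc k mod n = Suc k" if "k < n" for k
    using that by (cases "Suc k = n") auto
  ultimately have "Suc j = n \<and> i = 0 \<or> i = Suc j" "Suc i = n \<and> j = 0 \<or> j = Suc i"
    using n by metis+
  then show False
    using n(1) by presburger
qed

text \<open>On edges \<open>dichotomy\<close> and \<open>unit\<close> make the conditions on
  \<open>f\<close> and \<open>g\<close> complementary: the difference of \<open>f\<close> lies in
  \<open>I\<close> exactly when that of \<open>g\<close> lies outside \<open>A\<close>. Each color
  is thus described by membership in an additive group.\<close>

lemma NAC_coloring_of_ideal_pair:
  fixes f g :: "'a \<Rightarrow> 'k::comm_ring_1"
  assumes "ideal_pair A I" and E: "simple_graph V E"
    and dichotomy: "\<And>u v. {u, v} \<in> E \<Longrightarrow> f v - f u \<in> I \<or> g v - g u \<in> A"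
    and unit: "\<And>u v. {u, v} \<in> E \<Longrightarrow> \<exists>k\<in>A. (f v - f u) * (g v - g u) * k = 1"
    and red: "{u1, v1} \<in> E" "f v1 - f u1 \<in> I"
    and blue: "{u0, v0} \<in> E" "f v0 - f u0 \<notin> I"
  shows "\<exists>\<delta>. NAC_coloring E \<delta>"
proof -
  interpret ideal_pair A I by fact
  \<comment> \<open>The orientation of the edge is immaterial because \<open>I\<close> is closed
    under negation.\<close>
  define \<delta> where "\<delta> e = (if \<exists>u v. e = {u, v} \<and> f v - f u \<in> I then Red else Blue)" for e
  have sym: "f v - f u \<in> I \<longleftrightarrow> f u - f v \<in> I" for u v
    using ideal_minus by (metis minus_diff_eq)
  have red_iff: "\<delta> {u, v} = Red \<longleftrightarrow> f v - f u \<in> I" for u v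
  proof
    assume "\<delta> {u, v} = Red"
    then obtain a b where "{u, v} = {a, b}" "f b - f a \<in> I"
      by (auto simp: \<delta>_def split: if_splits)
    then show "f v - f u \<in> I"
      using sym by (auto simp: doubleton_eq_iff)
  qed (auto simp: \<delta>_def)
  have blue_iff: "\<delta> {u, v} = Blue \<longleftrightarrow> f v - f u \<notin> I" for u v
    using red_iff[of u v] by (cases "\<delta> {u, v}") auto
  have red_iff_A: "\<delta> {u, v} = Red \<longleftrightarrow> g v - g u \<notin> A" if uv: "{u, v} \<in> E" for u v
  proof
    assume "\<delta> {u, v} = Red"
    then have "f v - f u \<in> I"
      by (simp add: red_iff)
    moreover obtain k where k: "k \<in> A" "(f v - f u) * (g v - g u) * k = 1"
      using unit[OF uv] by blast
    ultimately have "1 \<in> I" if "g v - g u \<in> A"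
      using ideal_mult[of "f v - f u" "(g v - g u) * k"] mult_mem[OF that k(1)]
      by (simp add: mult.assoc)
    then show "g v - g u \<notin> A"
      using one_notin_ideal by blast
  qed (use dichotomy[OF uv] in \<open>simp add: red_iff\<close>)
  have "NAC_coloring E \<delta>"
    unfolding NAC_coloring_def
  proof (intro conjI allI impI)
    have "c \<in> \<delta> ` E" for c
      using red blue red_iff blue_iff by (cases c) (metis imageI)+
    then show "\<delta> ` E = UNIV"
      by blast
  next
    fix vs assume vs: "graph_cycle E vs"
    define n where "n = length vs"
    define e where "e i = {vs ! i, vs ! (Suc i mod n)}" for i
    have cycle: "cycle_edges vs = e ` {..<n}"
      by (auto simp: cycle_edges_def e_def n_def)
    have e_in: "e i \<in> E" if "i < n" for i
      using vs that by (auto simp: graph_cycle_def cycle)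
    show "(\<exists>c. \<forall>e\<in>cycle_edges vs. \<delta> e = c) \<or> (\<forall>c. card {e \<in> cycle_edges vs. \<delta> e = c} \<ge> 2)"
    proof (rule ccontr)
      assume "\<not> ?thesis"
      then obtain c where not_mono: "\<not> (\<exists>c. \<forall>e\<in>cycle_edges vs. \<delta> e = c)"
        and "card {e \<in> cycle_edges vs. \<delta> e = c} < 2"
        by (auto simp: not_le)
      \<comment> \<open>The cycle has both colors, so a color with fewer than two edges has exactly
        one.\<close>
      define S where "S = {e \<in> cycle_edges vs. \<delta> e = c}"
      have "S \<noteq> {}"
      proof
        assume "S = {}"
        moreover obtain c' where "\<And>b. b \<noteq> c \<Longrightarrow> b = c'"
          by (cases c) (metis color.exhaust)+
        ultimately have "\<forall>e\<in>cycle_edges vs. \<delta> e = c'"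
          unfolding S_def by blast
        then show False
          using not_mono by blast
      qed
      moreover have "finite S"
        by (simp add: S_def cycle)
      ultimately have "card S = 1"
        using \<open>card {e \<in> cycle_edges vs. \<delta> e = c} < 2\<close> card_gt_0_iff[of S] unfolding S_def by linarith
      then obtain s where s: "S = {s}"
        by (auto simp: card_1_singleton_iff)
      then have "s \<in> S"
        by simp
      then obtain i where i: "i < n" "s = e i"
        by (auto simp: S_def cycle)
      then have ci: "\<delta> (e i) = c"
        using s by (auto simp: S_def)
      have others: "\<delta> (e j) \<noteq> c" if "j < n" "j \<noteq> i" for j
      proof
        assume "\<delta> (e j) = c"
        then have "e j \<in> S"
          using that by (simp add: S_def cycle)
        then show False
          using cycle_edge_inj[OF vs, of j i] s i that by (simp add: e_def n_def)
      qed
      show False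
      \<comment> \<open>If the single edge is red, the blue edges have differences of
        \<open>g\<close> in \<open>A\<close>; if it is blue, the red edges have differences of
        \<open>f\<close> in \<open>I\<close>. Telescoping forces the same on the single
        edge.\<close>
      proof (cases c)
        case Red
        then have "\<delta> (e j) = Blue" if "j < n" "j \<noteq> i" for j
          using others[OF that] by (cases "\<delta> (e j)") auto
        then have rest: "g (vs ! (Suc j mod n)) - g (vs ! j) \<in> A" if "j < n" "j \<noteq> i" for j
          using that e_in[of j] red_iff_A by (fastforce simp: e_def)
        have "g (vs ! (Suc i mod n)) - g (vs ! i) \<in> A"
          unfolding n_def
          by (rule cycle_diff_mem[where J = A]) (use i rest in \<open>auto simp: n_def zero_mem diff_mem\<close>)
        then show False
          using red_iff_A e_in[OF i(1)] ci Red by (simp add: e_def)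
      next
        case Blue
        then have "\<delta> (e j) = Red" if "j < n" "j \<noteq> i" for j
          using others[OF that] by (cases "\<delta> (e j)") auto
        then have rest: "f (vs ! (Suc j mod n)) - f (vs ! j) \<in> I" if "j < n" "j \<noteq> i" for j
          using that red_iff by (simp add: e_def)
        have "f (vs ! (Suc i mod n)) - f (vs ! i) \<in> I"
          unfolding n_def
          by (rule cycle_diff_mem[where J = I]) (use i rest in \<open>auto simp: n_def ideal_zero ideal_diff\<close>)
        then show False
          using ci Blue blue_iff by (simp add: e_def)
      qed
    qed
  qed
  then show ?thesis
    by (intro exI[of _ \<delta>])
qed

text \<open>Properness is the point: if 1 were \<open>w\<close> times a polynomial in
  \<open>w\<close>, a polynomial with constant term -1 would vanish on the infinite range of
  \<open>w\<close>.\<close>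

lemma ideal_pair_of_infinite_range:
  fixes w :: "'b \<Rightarrow> complex"
  assumes "infinite (range w)"
  shows "ideal_pair (range (\<lambda>p t. poly p (w t))) (range (\<lambda>p t. w t * poly p (w t)))"
proof
  show "1 \<in> range (\<lambda>p t. poly p (w t))"
    by (intro range_eqI[of _ _ 1]) (simp add: fun_eq_iff)
  show "0 \<in> range (\<lambda>p t. w t * poly p (w t))"
    by (intro range_eqI[of _ _ 0]) (simp add: fun_eq_iff)
  show "range (\<lambda>p t. w t * poly p (w t)) \<subseteq> range (\<lambda>p t. poly p (w t))"
  proof safe
    fix p
    show "(\<lambda>t. w t * poly p (w t)) \<in> range (\<lambda>p t. poly p (w t))"
      by (intro range_eqI[of _ _ "[:0, 1:] * p"]) (simp add: fun_eq_iff)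
  qed
  show "1 \<notin> range (\<lambda>p t. w t * poly p (w t))"
  proof
    assume "1 \<in> range (\<lambda>p t. w t * poly p (w t))"
    then obtain p where p: "\<forall>t. w t * poly p (w t) = 1"
      by (auto simp: fun_eq_iff)
    define q where "q = [:0, 1:] * p - 1"
    have "poly q 0 \<noteq> 0"
      by (simp add: q_def)
    then have "q \<noteq> 0"
      by auto
    moreover have "range w \<subseteq> {z. poly q z = 0}"
      using p by (auto simp: q_def)
    ultimately show False
      using assms poly_roots_finite finite_subset by blast
  qed
next
  fix a b assume "a \<in> range (\<lambda>p t. poly p (w t))" "b \<in> range (\<lambda>p t. poly p (w t))"
  then obtain p q where "a = (\<lambda>t. poly p (w t))" "b = (\<lambda>t. poly q (w t))"
    by auto
  then show "a - b \<in> range (\<lambda>p t. poly p (w t))" "a * b \<in> range (\<lambda>p t. poly p (w t))"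
    by (force simp: fun_eq_iff intro: range_eqI[of _ _ "p - q"],
        force simp: fun_eq_iff intro: range_eqI[of _ _ "p * q"])
next
  fix a b assume "a \<in> range (\<lambda>p t. w t * poly p (w t))" "b \<in> range (\<lambda>p t. w t * poly p (w t))"
  then obtain p q where "a = (\<lambda>t. w t * poly p (w t))" "b = (\<lambda>t. w t * poly q (w t))"
    by auto
  then show "a - b \<in> range (\<lambda>p t. w t * poly p (w t))"
    by (auto simp: fun_eq_iff algebra_simps intro!: range_eqI[of _ _ "p - q"])
next
  fix a b assume "a \<in> range (\<lambda>p t. w t * poly p (w t))" "b \<in> range (\<lambda>p t. poly p (w t))"
  then obtain p q where "a = (\<lambda>t. w t * poly p (w t))" "b = (\<lambda>t. poly q (w t))"
    by auto
  then show "a * b \<in> range (\<lambda>p t. w t * poly p (w t))"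
    by (auto simp: fun_eq_iff intro!: range_eqI[of _ _ "p * q"])
qed

section \<open>The plane as the complex numbers\<close>

definition complex_of_vec :: "real^2 \<Rightarrow> complex" where
  "complex_of_vec p = Complex (p $ 1) (p $ 2)"

definition vec_of_complex :: "complex \<Rightarrow> real^2" where
  "vec_of_complex z = vector [Re z, Im z]"

lemma complex_of_vec_of_complex [simp]: "complex_of_vec (vec_of_complex z) = z"
  by (simp add: complex_of_vec_def vec_of_complex_def)

lemma vec_of_complex_of_vec [simp]: "vec_of_complex (complex_of_vec p) = p"
  by (simp add: complex_of_vec_def vec_of_complex_def vec_eq_iff forall_2)

lemma cmod_complex_of_vec_diff: "cmod (complex_of_vec p - complex_of_vec q) = dist p q"
  by (simp add: complex_of_vec_def cmod_def dist_norm norm_eq_sqrt_inner inner_vec_def sum_2 power2_eq_square)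

lemma continuous_on_complex_of_vec [continuous_intros]:
  "continuous_on S h \<Longrightarrow> continuous_on S (\<lambda>t. complex_of_vec (h t))"
  unfolding complex_of_vec_def Complex_eq by (intro continuous_intros)

text \<open>Undoes a rotation by \<open>q\<close> and carries \<open>a\<close> to \<open>b\<close>;
  this is the isometry that certifies a flex as trivial.\<close>

lemma euclidean_isometry_similarity:
  assumes "cmod q = 1"
  shows "euclidean_isometry (\<lambda>p. vec_of_complex (b + (complex_of_vec p - a) / q))"
  unfolding euclidean_isometry_def
proof (intro allI)
  fix x y :: "real^2"
  have "(b + (complex_of_vec x - a) / q) - (b + (complex_of_vec y - a) / q)
      = (complex_of_vec x - complex_of_vec y) / q"
    by (simp add: diff_divide_distrib)
  then show "dist (vec_of_complex (b + (complex_of_vec x - a) / q))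
      (vec_of_complex (b + (complex_of_vec y - a) / q)) = dist x y"
    using assms by (simp add: norm_divide flip: cmod_complex_of_vec_diff)
qed

text \<open>Directions of edges are measured relative to a fixed edge \<open>u\<^sub>0v\<^sub>0\<close>, which factors out rotations.\<close>

lemma nontrivial_flex_moves_edge:
  assumes conn: "graph_connected V E"
    and flex: "flex V E \<rho> \<epsilon> \<rho>t" and nontrivial: "\<not> trivial_flex V \<rho> \<epsilon> \<rho>t"
    and uv0: "{u0, v0} \<in> E" "u0 \<in> V" "v0 \<in> V"
    and d: "d = (\<lambda>u v t. complex_of_vec (\<rho>t t v) - complex_of_vec (\<rho>t t u))"
  shows "\<exists>u v. {u, v} \<in> E \<and> (\<exists>t\<in>{0..<\<epsilon>}. d u v t / d u0 v0 t \<noteq> d u v 0 / d u0 v0 0)"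
proof (rule ccontr)
  assume "\<not> ?thesis"
  then have const: "d u v t / d u0 v0 t = d u v 0 / d u0 v0 0" if "{u, v} \<in> E" "t \<in> {0..<\<epsilon>}" for u v t
    using that by blast
  have norm_d: "cmod (d u0 v0 t) = cmod (d u0 v0 0)" and d_nonzero: "d u0 v0 t \<noteq> 0"
    if "t \<in> {0..<\<epsilon>}" for t
  proof -
    have "norm (\<rho>t s u0 - \<rho>t s v0) = norm (\<rho> u0 - \<rho> v0)" if "s \<in> {0..<\<epsilon>}" for s
      using flex that uv0 by (auto simp: flex_def)
    moreover have "0 \<in> {0..<\<epsilon>}"
      using flex by (simp add: flex_def)
    ultimately show "cmod (d u0 v0 t) = cmod (d u0 v0 0)"
      using that by (simp add: d cmod_complex_of_vec_diff dist_norm norm_minus_commute)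
    have "\<rho>t t u0 \<noteq> \<rho>t t v0"
      using flex that uv0 by (auto simp: flex_def realization_def)
    then show "d u0 v0 t \<noteq> 0"
      using cmod_complex_of_vec_diff[of "\<rho>t t v0" "\<rho>t t u0"] by (auto simp: d)
  qed
  have "trivial_flex V \<rho> \<epsilon> \<rho>t"
    unfolding trivial_flex_def
  proof
    fix t assume t: "t \<in> {0..<\<epsilon>}"
    \<comment> \<open>The rotation of the fixed edge between times 0 and \<open>t\<close>; it has
      modulus one because the length is preserved. Constant ratios mean that every edge turns by
      this same \<open>q\<close>.\<close>
    define q where "q = d u0 v0 t / d u0 v0 0"
    have zero: "0 \<in> {0..<\<epsilon>}" and start: "\<And>v. v \<in> V \<Longrightarrow> \<rho>t 0 v = \<rho> v"
      using flex by (auto simp: flex_def)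
    have "d u0 v0 0 \<noteq> 0" "d u0 v0 t \<noteq> 0"
      using d_nonzero t zero by blast+
    then have q: "cmod q = 1" "q \<noteq> 0"
      using norm_d[OF t] by (auto simp: q_def norm_divide)
    have edge: "d u v t = q * d u v 0" if "{u, v} \<in> E" for u v
      using const[OF that t] \<open>d u0 v0 0 \<noteq> 0\<close> \<open>d u0 v0 t \<noteq> 0\<close> by (simp add: q_def field_simps)
    \<comment> \<open>Summing edge vectors along a path from \<open>u0\<close> extends the common
      rotation to all vertices.\<close>
    have rotate: "d u0 v t = q * d u0 v 0" if "v \<in> V" for v
    proof -
      have "(u0, v) \<in> {(x, y). {x, y} \<in> E}\<^sup>*"
        using conn uv0 that by (auto simp: graph_connected_def)
      then show ?thesis
      proof induction
        case (step y z)
        have "d u0 z s = d u0 y s + d y z s" for s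
          by (simp add: d)
        then show ?case
          using step edge[of y z] by (simp add: algebra_simps)
      qed (simp add: d)
    qed
    define M where "M = (\<lambda>p. vec_of_complex (complex_of_vec (\<rho> u0) +
        (complex_of_vec p - complex_of_vec (\<rho>t t u0)) / q))"
    have "M (\<rho>t t v) = \<rho> v" if "v \<in> V" for v
    proof -
      have "(complex_of_vec (\<rho>t t v) - complex_of_vec (\<rho>t t u0)) / q
          = complex_of_vec (\<rho> v) - complex_of_vec (\<rho> u0)"
        using rotate[OF that] q start[OF that] start[OF uv0(2)] by (simp add: d)
      then show ?thesis
        by (simp add: M_def)
    qed
    moreover have "euclidean_isometry M"
      unfolding M_def using q(1) by (rule euclidean_isometry_similarity)
    ultimately show "\<exists>M. euclidean_isometry M \<and> (\<forall>v\<in>V. M (\<rho>t t v) = \<rho> v)"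
      by blast
  qed
  then show False
    using nontrivial by simp
qed

lemma flexible_imp_NAC_coloring:
  assumes E: "simple_graph V E" and conn: "graph_connected V E" and nonempty: "E \<noteq> {}"
    and "flexible V E \<rho>"
  shows "\<exists>\<delta>. NAC_coloring E \<delta>"
proof -
  obtain \<epsilon> \<rho>t where flex: "flex V E \<rho> \<epsilon> \<rho>t" and nontrivial: "\<not> trivial_flex V \<rho> \<epsilon> \<rho>t"
    using assms(4) by (auto simp: flexible_def)
  have mem: "u \<in> V" "v \<in> V" if "{u, v} \<in> E" for u v
    using E that by (auto simp: simple_graph_def)
  obtain u0 v0 where uv0: "{u0, v0} \<in> E"
    using nonempty E by (auto simp: simple_graph_def card_2_iff) metis
  define d where "d = (\<lambda>u v t. complex_of_vec (\<rho>t t v) - complex_of_vec (\<rho>t t u))"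
  obtain u1 v1 t1 where uv1: "{u1, v1} \<in> E" and t1: "t1 \<in> {0..<\<epsilon>}"
    "d u1 v1 t1 / d u0 v0 t1 \<noteq> d u1 v1 0 / d u0 v0 0"
    using nontrivial_flex_moves_edge[OF conn flex nontrivial uv0 mem[OF uv0] d_def] by blast
  \<comment> \<open>Elements of the ambient ring are functions on all of the reals; times outside
    the interval are sent to 0, so the edge lengths remain correct everywhere.\<close>
  define T where "T t = (if t \<in> {0..<\<epsilon>} then t else 0)" for t
  have zero: "0 \<in> {0..<\<epsilon>}"
    using flex by (simp add: flex_def)
  then have T: "T t \<in> {0..<\<epsilon>}" for t
    by (simp add: T_def)
  have cmod_d: "cmod (d u v t) = norm (\<rho> u - \<rho> v)" if "{u, v} \<in> E" "t \<in> {0..<\<epsilon>}" for u v t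
    using flex that by (simp add: d_def cmod_complex_of_vec_diff dist_norm flex_def norm_minus_commute)
  have length: "norm (\<rho> u - \<rho> v) \<noteq> 0" if "{u, v} \<in> E" for u v
    using flex that mem[OF that] zero unfolding flex_def realization_def by (metis norm_eq_zero right_minus_eq)
  have d_nonzero: "d u v t \<noteq> 0" if "{u, v} \<in> E" "t \<in> {0..<\<epsilon>}" for u v t
    using cmod_d[OF that] length[OF that(1)] by auto
  define f where "f v = (\<lambda>t. complex_of_vec (\<rho>t (T t) v) / d u0 v0 (T t))" for v
  define g where "g v = (\<lambda>t. cnj (f v t))" for v
  have f_diff: "f v - f u = (\<lambda>t. d u v (T t) / d u0 v0 (T t))" for u v
    by (simp add: f_def d_def fun_eq_iff diff_divide_distrib)
  have g_diff: "(g v - g u) t = cnj ((f v - f u) t)" for u v t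
    by (simp add: g_def)
  define w where "w = f v1 - f u1"
  define A0 where "A0 = range (\<lambda>p t. poly p (w t))"
  define I0 where "I0 = range (\<lambda>p t. w t * poly p (w t))"
  \<comment> \<open>A continuous image of an interval is connected, so with two distinct values it
    has infinitely many.\<close>
  have "infinite (range w)"
  proof -
    define h where "h t = d u1 v1 t / d u0 v0 t" for t
    have "continuous_on {0..<\<epsilon>} (\<lambda>t. \<rho>t t v)" if "v \<in> V" for v
      using flex that by (simp add: flex_def)
    then have "continuous_on {0..<\<epsilon>} h"
      unfolding h_def using d_nonzero[OF uv0] mem[OF uv0] mem[OF uv1]
      by (intro continuous_intros) (auto simp: d_def intro!: continuous_intros)
    then have conn: "connected (h ` {0..<\<epsilon>})"
      by (intro connected_continuous_image) auto
    have "infinite (h ` {0..<\<epsilon>})"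
    proof
      assume "finite (h ` {0..<\<epsilon>})"
      with conn have "h ` {0..<\<epsilon>} = {} \<or> (\<exists>x. h ` {0..<\<epsilon>} = {x})"
        using connected_finite_iff_sing by blast
      moreover have "h t1 \<in> h ` {0..<\<epsilon>}" "h 0 \<in> h ` {0..<\<epsilon>}"
        using t1(1) zero by blast+
      ultimately have "h t1 = h 0"
        by (metis empty_iff singletonD)
      then show False
        using t1(2) by (simp add: h_def)
    qed
    moreover have "h ` {0..<\<epsilon>} \<subseteq> range w"
    proof
      fix z assume "z \<in> h ` {0..<\<epsilon>}"
      then obtain t where "t \<in> {0..<\<epsilon>}" "z = h t"
        by blast
      then have "z = w t"
        by (simp add: w_def f_diff h_def T_def)
      then show "z \<in> range w"
        by blast
    qed
    ultimately show ?thesis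
      using finite_subset by blast
  qed
  then have "ideal_pair A0 I0"
    unfolding A0_def I0_def by (rule ideal_pair_of_infinite_range)
  then obtain A I where AI: "ideal_pair A I" "A0 \<subseteq> A" "I0 \<subseteq> I"
    and dichotomy: "\<And>x y. x * y = 1 \<Longrightarrow> x \<in> I \<or> y \<in> A"
    by (rule ideal_pair_extension) blast
  interpret ideal_pair A I by fact
  have const: "(\<lambda>_. c) \<in> A" for c
  proof -
    have "(\<lambda>_. c) \<in> A0"
      unfolding A0_def by (intro range_eqI[of _ _ "[:c:]"]) simp
    then show ?thesis
      using AI(2) by blast
  qed
  \<comment> \<open>The inverse of the constant squared modulus of a normalised edge direction.
    Constant functions lie in \<open>A\<close>, so this factor can be put in and taken out
    again.\<close>
  define \<kappa> where "\<kappa> u v = complex_of_real ((norm (\<rho> u0 - \<rho> v0) / norm (\<rho> u - \<rho> v))\<^sup>2)" for u v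
  have unit: "(f v - f u) * (g v - g u) * (\<lambda>_. \<kappa> u v) = 1" if uv: "{u, v} \<in> E" for u v
  proof
    fix t
    have "(f v - f u) t * (g v - g u) t = complex_of_real ((cmod ((f v - f u) t))\<^sup>2)"
      unfolding g_diff by (rule complex_norm_square[symmetric])
    also have "cmod ((f v - f u) t) = norm (\<rho> u - \<rho> v) / norm (\<rho> u0 - \<rho> v0)"
      by (simp only: f_diff norm_divide cmod_d[OF uv T] cmod_d[OF uv0 T])
    finally have "(f v - f u) t * (g v - g u) t * \<kappa> u v = complex_of_real
        ((norm (\<rho> u - \<rho> v) / norm (\<rho> u0 - \<rho> v0))\<^sup>2 * (norm (\<rho> u0 - \<rho> v0) / norm (\<rho> u - \<rho> v))\<^sup>2)"
      by (simp only: \<kappa>_def of_real_mult)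
    also have "\<dots> = 1"
      using length[OF uv] length[OF uv0] by (simp flip: power_mult_distrib)
    finally show "((f v - f u) * (g v - g u) * (\<lambda>_. \<kappa> u v)) t = 1 t"
      by simp
  qed
  show ?thesis
  proof (rule NAC_coloring_of_ideal_pair[OF AI(1) E _ _ uv1 _ uv0])
    show "\<exists>k\<in>A. (f v - f u) * (g v - g u) * k = 1" if "{u, v} \<in> E" for u v
      using unit[OF that] const by blast
    show "f v - f u \<in> I \<or> g v - g u \<in> A" if uv: "{u, v} \<in> E" for u v
    proof -
      have "\<kappa> u v \<noteq> 0"
        using length[OF uv] length[OF uv0] by (simp add: \<kappa>_def)
      \<comment> \<open>The dichotomy concerns exact inverses, so it is applied to
        \<open>(g v - g u)\<close> scaled by \<open>\<kappa> u v\<close>, and the scaling is then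
        undone inside \<open>A\<close>.\<close>
      then have "g v - g u = (g v - g u) * (\<lambda>_. \<kappa> u v) * (\<lambda>_. inverse (\<kappa> u v))"
        by (simp add: fun_eq_iff)
      moreover have "f v - f u \<in> I \<or> (g v - g u) * (\<lambda>_. \<kappa> u v) \<in> A"
        using dichotomy unit[OF uv] by (simp only: mult.assoc)
      ultimately show ?thesis
        using mult_mem const by metis
    qed
    \<comment> \<open>The moving edge becomes red and the fixed edge, with normalised direction 1,
      becomes blue; so both colors occur.\<close>
    have "w \<in> I0"
      unfolding I0_def by (intro range_eqI[of _ _ 1]) simp
    then show "f v1 - f u1 \<in> I"
      using AI(3) by (auto simp: w_def)
    have "f v0 - f u0 = 1"
      using d_nonzero[OF uv0 T] by (simp add: f_diff fun_eq_iff)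
    then show "f v0 - f u0 \<notin> I"
      using one_notin_ideal by simp
  qed
qed

theorem theorem1p1:
  fixes V :: "'a set" and E :: "'a set set"
  assumes "simple_graph V E"
    and "graph_connected V E"
    and "countable V" and "infinite V"
  shows "(\<exists>\<rho>. realization E \<rho> \<and> flexible V E \<rho>) \<longleftrightarrow> (\<exists>\<delta>. NAC_coloring E \<delta>)"
proof
  assume "\<exists>\<rho>. realization E \<rho> \<and> flexible V E \<rho>"
  \<comment> \<open>A connected graph without edges has at most one vertex; an edge is needed to
    normalise the directions.\<close>
  moreover have "E \<noteq> {}"
  proof
    assume "E = {}"
    then have "\<forall>u\<in>V. \<forall>v\<in>V. u = v"
      using assms(2) by (simp add: graph_connected_def)
    then have "V = {} \<or> (\<exists>v. V = {v})"
      by blast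
    then show False
      using assms(4) by auto
  qed
  ultimately show "\<exists>\<delta>. NAC_coloring E \<delta>"
    using flexible_imp_NAC_coloring assms(1,2) by blast
next
  assume "\<exists>\<delta>. NAC_coloring E \<delta>"
  then show "\<exists>\<rho>. realization E \<rho> \<and> flexible V E \<rho>"
    using NAC_coloring_imp_flexible assms(1,3) by blast
qed

end
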